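(* Applying the KP algorithm to the defining identities of Jordan triple systems produces two trilinear operations $\{-,-,-\}_1$ and $\{-,-,-\}_2$ satisfying these identities: \begin{align*} &\{a,b,c\}_2 \equiv \{c,b,a\}_2,\\ &\{ a, \{ b, c, d \}_1, e \}_1 \equiv \{ a, \{ b, c, d \}_2, e \}_1 \equiv \{ a, \{ d, c, b \}_1, e \}_1,\\ &\{ a, b, \{ c, d, e \}_1 \}_1 \equiv \{ a, b, \{ c, d, e \}_2 \}_1 \equiv \{ a, b, \{ e, d, c \}_1 \}_1,\\ &\{ \{ a, b, c \}_1, d, e \}_2 \equiv \{ \{ a, b, c \}_2, d, e \}_2 \equiv \{ \{ c, b, a \}_1, d, e \}_2,\\ &\{ \{ e, d, c \}_1, b, a \}_1 \equiv \{ \{ e, b, a \}_1, d, c \}_1 - \{ e, \{ d, a, b \}_1, c \}_1 + \{ e, d, \{ c, b, a \}_1 \}_1,\\ &\{ \{ e, d, c \}_2, b, a \}_1 \equiv \{ \{ e, b, a \}_1, d, c \}_2 - \{ e, \{ d, a, b \}_1, c \}_2 + \{ e, d, \{ c, b, a \}_1 \}_2,\\ &\{ a, b, \{ c, d, e \}_1 \}_1 \equiv \{ \{ a, b, c \}_1, d, e \}_1 - \{ c, \{ b, a, d \}_2, e \}_2 + \{ \{ a, b, e \}_1, d, c \}_1,\\ &\{ a, b, \{ c, d, e \}_1 \}_2 \equiv \{ \{ a, b, c \}_2, d, e \}_1 - \{ c, \{ b, a, d \}_1, e \}_2 + \{ \{ a, b, e \}_2, d, c \}_1. \end{align*}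
   Context: The symbol $\equiv$ means equality for all values of the variables. A (linear) Jordan triple system is a vector space $T$ over a field of characteristic not $2$ with a trilinear operation $T\times T\times T\to T$, denoted $\{-,-,-\}$, satisfying the polynomial identities $$\{a,b,c\}\equiv\{c,b,a\},\qquad \{a,b,\{c,d,e\}\}\equiv\{\{a,b,c\},d,e\}-\{c,\{b,a,d\},e\}+\{c,d,\{a,b,e\}\}.$$ These are the defining identities of Jordan triple systems. The KP (Kolesnikov-Pozhidaev) algorithm is applied to multilinear identities in a multilinear $n$-ary operation $\{-,\dots,-\}$ (here $n=3$). It introduces $n$ new $n$-ary operations $\{-,\dots,-\}_1,\dots,\{-,\dots,-\}_n$ and produces the following identities for them. Part 1. For each given multilinear identity of degree $d$ in variables $a_1,\dots,a_d$, and for each $i\in\{1,\dots,d\}$, one obtains a new identity of degree $d$ by taking $a_i$ as the central argument and converting each monomial as follows (extending linearly to the whole identity). For each occurrence of the operation symbol $\{\dots\}$ in the monomial: if $a_i$ occurs within the $j$-th argument of that occurrence, replace $\{\dots\}$ by $\{\dots\}_j$; if $a_i$ does not occur within any of its $n$ arguments, replace $\{\dots\}$ by $\{\dots\}_1$ when $a_i$ occurs to the left of that operation symbol, and by $\{\dots\}_n$ when $a_i$ occurs to the right of it. Part 2. In addition one includes, for all $i,j\in\{1,\dots,n\}$ with $i\ne j$ and all $k,\ell\in\{1,\dots,n\}$, the identity $$\{a_1,\dots,a_{i-1},\{b_1,\dots,b_n\}_k,a_{i+1},\dots,a_n\}_j\equiv\{a_1,\dots,a_{i-1},\{b_1,\dots,b_n\}_\ell,a_{i+1},\dots,a_n\}_j.$$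 *)

theory Defs
  imports Complex_Main
begin

text \<open>
  Nonassociative monomials in variables of type \<^typ>\<open>'v\<close>, whose operation symbols are labelled by
  elements of \<^typ>\<open>'o\<close>. With a single unlabelled operation, \<^typ>\<open>'o\<close> is \<^typ>\<open>unit\<close>; the new operations
  \<open>{\<dots>}\<^sub>1, \<dots>, {\<dots>}\<^sub>n\<close> are labelled by the natural numbers \<open>1, \<dots>, n\<close>.
\<close>

datatype (ops: 'o, vars: 'v) monomial = Var 'v | Op 'o "('o, 'v) monomial list"

text \<open>A formal linear combination is a list of summands, and an identity \<open>f \<equiv> g\<close> is the pair of its sides.\<close>

type_synonym ('k, 'o, 'v) combination = "('k \<times> ('o, 'v) monomial) list"
type_synonym ('k, 'o, 'v) identity = "('k, 'o, 'v) combination \<times> ('k, 'o, 'v) combination"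

definition monomials :: "('k, 'o, 'v) identity \<Rightarrow> ('o, 'v) monomial set" where
  "monomials I = snd ` set (fst I) \<union> snd ` set (snd I)"

definition identity_vars :: "('k, 'o, 'v) identity \<Rightarrow> 'v set" where
  "identity_vars I = (\<Union>m\<in>monomials I. vars m)"

fun eval_monomial :: "('o \<Rightarrow> 'b list \<Rightarrow> 'b) \<Rightarrow> ('v \<Rightarrow> 'b) \<Rightarrow> ('o, 'v) monomial \<Rightarrow> 'b" where
  "eval_monomial F \<sigma> (Var x) = \<sigma> x"
| "eval_monomial F \<sigma> (Op l ts) = F l (map (eval_monomial F \<sigma>) ts)"

definition eval_combination ::
  "('k \<Rightarrow> 'b::ab_group_add \<Rightarrow> 'b) \<Rightarrow> ('o \<Rightarrow> 'b list \<Rightarrow> 'b) \<Rightarrow> ('v \<Rightarrow> 'b) \<Rightarrow> ('k, 'o, 'v) combination \<Rightarrow> 'b" where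
  "eval_combination scale F \<sigma> cs = (\<Sum>(c, m)\<leftarrow>cs. scale c (eval_monomial F \<sigma> m))"

definition satisfies ::
  "('k \<Rightarrow> 'b::ab_group_add \<Rightarrow> 'b) \<Rightarrow> ('o \<Rightarrow> 'b list \<Rightarrow> 'b) \<Rightarrow> ('k, 'o, 'v) identity \<Rightarrow> bool" where
  "satisfies scale F I \<longleftrightarrow>
    (\<forall>\<sigma> :: 'v \<Rightarrow> 'b.
      eval_combination scale F \<sigma> (fst I) = eval_combination scale F \<sigma> (snd I))"

text \<open>
  \<open>kp_monomial n v left m\<close> converts the monomial \<open>m\<close>, a factor of a multilinear monomial with
  central argument \<open>v\<close>. The flag \<open>left\<close> records whether \<open>v\<close> has occurred to the left of \<open>m\<close> in the
  surrounding monomial, so an operation symbol of \<open>m\<close> without \<open>v\<close> among its arguments gets label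
  \<open>1\<close> if the flag is set, and \<open>n\<close> otherwise. Argument positions are counted from \<open>1\<close>.
\<close>

definition arg_pos :: "'v \<Rightarrow> ('o, 'v) monomial list \<Rightarrow> nat" where
  "arg_pos v ts = Suc (length (takeWhile (\<lambda>t. v \<notin> vars t) ts))"

fun kp_monomial :: "nat \<Rightarrow> 'v \<Rightarrow> bool \<Rightarrow> (unit, 'v) monomial \<Rightarrow> (nat, 'v) monomial"
  and kp_args :: "nat \<Rightarrow> 'v \<Rightarrow> bool \<Rightarrow> (unit, 'v) monomial list \<Rightarrow> (nat, 'v) monomial list" where
  "kp_monomial n v left (Var x) = Var x"
| "kp_monomial n v left (Op _ ts) =
    Op (if \<exists>t\<in>set ts. v \<in> vars t then arg_pos v ts else if left then 1 else n)
       (kp_args n v left ts)"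
| "kp_args n v left [] = []"
| "kp_args n v left (t # ts) = kp_monomial n v left t # kp_args n v (left \<or> v \<in> vars t) ts"

definition kp_combination ::
  "nat \<Rightarrow> 'v \<Rightarrow> ('k, unit, 'v) combination \<Rightarrow> ('k, nat, 'v) combination" where
  "kp_combination n v cs = map (\<lambda>(c, m). (c, kp_monomial n v False m)) cs"

definition kp_part1 :: "nat \<Rightarrow> ('k, unit, 'v) identity set \<Rightarrow> ('k, nat, 'v) identity set" where
  "kp_part1 n Is =
    {(kp_combination n v (fst I), kp_combination n v (snd I)) | v I. I \<in> Is \<and> v \<in> identity_vars I}"

text \<open>In Part 2 the variables \<open>a\<^sub>1, \<dots>, a\<^sub>n, b\<^sub>1, \<dots>, b\<^sub>n\<close> are encoded as the numbers \<open>1, \<dots>, 2n\<close>.\<close>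

definition kp_part2_monomial :: "nat \<Rightarrow> nat \<Rightarrow> nat \<Rightarrow> nat \<Rightarrow> (nat, nat) monomial" where
  "kp_part2_monomial n i j k =
    Op j (map (\<lambda>m. if m = i then Op k (map (\<lambda>m'. Var (n + m')) [1..<Suc n]) else Var m) [1..<Suc n])"

definition kp_part2 :: "nat \<Rightarrow> ('k::field, nat, nat) identity set" where
  "kp_part2 n =
    {([(1, kp_part2_monomial n i j k)], [(1, kp_part2_monomial n i j l)]) | i j k l.
      i \<in> {1..n} \<and> j \<in> {1..n} \<and> i \<noteq> j \<and> k \<in> {1..n} \<and> l \<in> {1..n}}"

definition kp_identities ::
  "nat \<Rightarrow> ('k::field, unit, nat) identity set \<Rightarrow> ('k, nat, nat) identity set" where
  "kp_identities n Is = kp_part1 n Is \<union> kp_part2 n"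

text \<open>The variables \<open>a, b, c, d, e\<close> of the Jordan triple identities are encoded as \<open>1, \<dots>, 5\<close>.\<close>

definition jts_identities :: "('k::field, unit, nat) identity set" where
  "jts_identities =
    (let T = (\<lambda>x y z. Op () [x, y, z]);
         a = Var 1; b = Var 2; c = Var 3; d = Var 4; e = Var 5
     in {([(1, T a b c)], [(1, T c b a)]),
         ([(1, T a b (T c d e))],
          [(1, T (T a b c) d e), (- 1, T c (T b a d) e), (1, T c d (T a b e))])})"

definition trilinear :: "('k::field \<Rightarrow> 'b::ab_group_add \<Rightarrow> 'b) \<Rightarrow> ('b \<Rightarrow> 'b \<Rightarrow> 'b \<Rightarrow> 'b) \<Rightarrow> bool" where
  "trilinear scale f \<longleftrightarrow>
    (\<forall>y z. Vector_Spaces.linear scale scale (\<lambda>x. f x y z)) \<and>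
    (\<forall>x z. Vector_Spaces.linear scale scale (\<lambda>y. f x y z)) \<and>
    (\<forall>x y. Vector_Spaces.linear scale scale (\<lambda>z. f x y z))"

text \<open>Interpretation of the labels \<open>1, 2, 3\<close>; only these labels and argument lists of length 3 matter.\<close>

definition ternary_ops ::
  "('b \<Rightarrow> 'b \<Rightarrow> 'b \<Rightarrow> 'b) \<Rightarrow> ('b \<Rightarrow> 'b \<Rightarrow> 'b \<Rightarrow> 'b) \<Rightarrow> ('b \<Rightarrow> 'b \<Rightarrow> 'b \<Rightarrow> 'b) \<Rightarrow> nat \<Rightarrow> 'b list \<Rightarrow> 'b" where
  "ternary_ops t1 t2 t3 j xs =
    (if j = 1 then t1 else if j = 2 then t2 else t3) (xs ! 0) (xs ! 1) (xs ! 2)"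

text \<open>Sanity check: the syntactic identities are the defining identities of Jordan triple systems.\<close>

lemma (in vector_space) satisfies_jts_identities_iff:
  "(\<forall>I\<in>jts_identities. satisfies scale (\<lambda>_ xs. t (xs ! 0) (xs ! 1) (xs ! 2)) I) \<longleftrightarrow>
    (\<forall>a b c. t a b c = t c b a) \<and>
    (\<forall>a b c d e. t a b (t c d e) = t (t a b c) d e - t c (t b a d) e + t c d (t a b e))"
    (is "?L \<longleftrightarrow> ?R")
proof
  assume L: ?L
  show ?R
  proof (intro conjI allI)
    fix a b c d e :: 'b
    let ?s = "\<lambda>m::nat. if m = 1 then a else if m = 2 then b else if m = 3 then c else if m = 4 then d else e"
    have S: "\<And>I. I \<in> jts_identities \<Longrightarrow>
        eval_combination scale (\<lambda>_ xs. t (xs ! 0) (xs ! 1) (xs ! 2)) ?s (fst I) =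
        eval_combination scale (\<lambda>_ xs. t (xs ! 0) (xs ! 1) (xs ! 2)) ?s (snd I)"
      using L unfolding satisfies_def by blast
    show "t a b c = t c b a"
      using S[of "(x, y)" for x y, unfolded jts_identities_def Let_def, OF insertI1]
      by (simp add: eval_combination_def)
    show "t a b (t c d e) = t (t a b c) d e - t c (t b a d) e + t c d (t a b e)"
      using S[of "(x, y)" for x y, unfolded jts_identities_def Let_def, OF insertI2, OF insertI1]
      by (simp add: eval_combination_def)
  qed
next
  assume R: ?R
  show ?L
  proof
    fix I :: "('a, unit, nat) identity"
    assume "I \<in> jts_identities"
    then consider
        "I = ([(1, Op () [Var 1, Var 2, Var 3])], [(1, Op () [Var 3, Var 2, Var 1])])"
      | "I = ([(1, Op () [Var 1, Var 2, Op () [Var 3, Var 4, Var 5]])],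
          [(1, Op () [Op () [Var 1, Var 2, Var 3], Var 4, Var 5]),
           (- 1, Op () [Var 3, Op () [Var 2, Var 1, Var 4], Var 5]),
           (1, Op () [Var 3, Var 4, Op () [Var 1, Var 2, Var 5]])])"
      unfolding jts_identities_def Let_def by blast
    then show "satisfies scale (\<lambda>_ xs. t (xs ! 0) (xs ! 1) (xs ! 2)) I"
    proof cases
      case 1
      then show ?thesis
        by (simp add: satisfies_def eval_combination_def) (use R in blast)
    next
      case 2
      then show ?thesis
        by (simp add: satisfies_def eval_combination_def R[THEN conjunct2, rule_format, of _ _ "_ 3"])
    qed
  qed
qed

end

theory Submission
  imports Defs
begin

text \<open>
  The output of the KP algorithm is a finite list of identities, and the theorem is a reduction of
  that list to a shorter one.

  Applied to \<open>{a, b, c} \<equiv> {c, b, a}\<close>, Part 1 with central argument \<open>a\<close> (or \<open>c\<close>) says that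
  \<open>{a, b, c}\<^sub>3\<close> is \<open>{c, b, a}\<^sub>1\<close>, and with central argument \<open>b\<close> that \<open>{-, -, -}\<^sub>2\<close> is symmetric in its
  outer arguments (\<open>satisfies_kp_reversal_iff\<close>). So \<open>{-, -, -}\<^sub>3\<close> can be eliminated everywhere.

  Part 2 says that an inner operation may be replaced by any other one unless its position
  in the outer operation is the label of the latter (\<open>satisfies_kp_part2_iff\<close>). After the elimination of \<open>{-, -, -}\<^sub>3\<close>
  only three of the six positions are essentially different, and interchanging \<open>{-, -, -}\<^sub>1\<close> with
  \<open>{-, -, -}\<^sub>3\<close> becomes reversing the arguments of \<open>{-, -, -}\<^sub>1\<close>: these are the three chains of
  equations of degree five (\<open>interchange_iff_if_reversal\<close>).

  The Jordan identity of degree five gives one identity for each of its five variables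
  (\<open>satisfies_kp_derivation_iff\<close>). Those for \<open>a\<close> and \<open>b\<close> are the last two of the theorem. Those for
  \<open>c\<close> and \<open>d\<close> are the two before these, after a renaming of variables and reversals of inner operations
  that Part 2 allows. The one for \<open>e\<close> agrees with the one for \<open>c\<close>, because \<open>{c, d, e}\<close> is
  symmetric in \<open>c\<close> and \<open>e\<close>, and the right side of the Jordan identity is so too, up to the symmetry of
  the operation (\<open>derivation_iff_if_reversal\<close>). Hence four of the five survive.
\<close>

section \<open>Evaluation of identities in finitely many variables\<close>

text \<open>
  All identities here have their variables among \<open>1, \<dots>, 6\<close>, so a quantifier over assignments
  is one over six values. The predicate \<open>P\<close> may ignore some of them.
\<close>

lemma satisfies_iff_values:
  fixes scale :: "'k \<Rightarrow> 'b::ab_group_add \<Rightarrow> 'b" and I :: "('k, 'o, nat) identity"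
  assumes "\<And>\<sigma>. eval_combination scale F \<sigma> (fst I) = eval_combination scale F \<sigma> (snd I) \<longleftrightarrow>
    P (\<sigma> 1) (\<sigma> 2) (\<sigma> 3) (\<sigma> 4) (\<sigma> 5) (\<sigma> 6)"
  shows "satisfies scale F I \<longleftrightarrow> (\<forall>a b c d e f. P a b c d e f)"
proof
  assume I: "satisfies scale F I"
  show "\<forall>a b c d e f. P a b c d e f"
  proof (intro allI)
    fix a b c d e f :: 'b
    \<comment> \<open>Variables are numbered from \<open>1\<close>, list positions from \<open>0\<close>.\<close>
    let ?\<sigma> = "\<lambda>m. [a, b, c, d, e, f] ! (m - 1)"
    show "P a b c d e f"
      using I assms[of ?\<sigma>] by (simp add: satisfies_def)
  qed
next
  assume "\<forall>a b c d e f. P a b c d e f"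
  then show "satisfies scale F I"
    by (simp add: satisfies_def assms)
qed

lemma ball_kp_part1_iff:
  "(\<forall>J\<in>kp_part1 n Is. Q J) \<longleftrightarrow>
    (\<forall>I\<in>Is. \<forall>v\<in>identity_vars I. Q (kp_combination n v (fst I), kp_combination n v (snd I)))"
  unfolding kp_part1_def by blast

section \<open>The identities produced by the algorithm\<close>

context vector_space
begin

text \<open>
  The central arguments \<open>a\<close> and \<open>c\<close> give the same identity up to renaming, which is why three
  variables yield two conditions.
\<close>

lemma satisfies_kp_reversal_iff:
  fixes t1 t2 t3 :: "'b \<Rightarrow> 'b \<Rightarrow> 'b \<Rightarrow> 'b"
  defines "I \<equiv> ([(1, Op () [Var 1, Var 2, Var 3])], [(1, Op () [Var 3, Var 2, Var 1])])
    :: ('a, unit, nat) identity"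
  shows "(\<forall>v\<in>identity_vars I.
      satisfies scale (ternary_ops t1 t2 t3) (kp_combination 3 v (fst I), kp_combination 3 v (snd I))) \<longleftrightarrow>
    (\<forall>a b c. t3 a b c = t1 c b a) \<and> (\<forall>a b c. t2 a b c = t2 c b a)"
proof -
  let ?sat = "\<lambda>v. satisfies scale (ternary_ops t1 t2 t3)
    (kp_combination 3 v (fst I), kp_combination 3 v (snd I))"
  note eval_defs = I_def kp_combination_def eval_combination_def ternary_ops_def arg_pos_def
  have vars: "identity_vars I = {1, 2, 3}"
    by (auto simp: I_def identity_vars_def monomials_def)
  have "?sat 1 \<longleftrightarrow> (\<forall>a b c (d :: 'b) (e :: 'b) (f :: 'b). t1 a b c = t3 c b a)"
    by (rule satisfies_iff_values) (simp add: eval_defs)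
  moreover have "?sat 2 \<longleftrightarrow> (\<forall>a b c (d :: 'b) (e :: 'b) (f :: 'b). t2 a b c = t2 c b a)"
    by (rule satisfies_iff_values) (simp add: eval_defs)
  moreover have "?sat 3 \<longleftrightarrow> (\<forall>a b c (d :: 'b) (e :: 'b) (f :: 'b). t3 a b c = t1 c b a)"
    by (rule satisfies_iff_values) (simp add: eval_defs)
  ultimately show ?thesis
    unfolding vars by auto
qed

text \<open>
  The conditions are listed in the order of the central argument \<open>a, \<dots>, e\<close>. An inner operation
  without the central argument gets label \<open>1\<close> or \<open>3\<close> according to the side on which the central
  argument lies. In the fourth condition, for instance, \<open>{b, a, d}\<close> contains the central argument
  \<open>d\<close>, which lies to the left of \<open>{a, b, e}\<close> and to the right of \<open>{a, b, c}\<close>.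
\<close>

lemma satisfies_kp_derivation_iff:
  fixes t1 t2 t3 :: "'b \<Rightarrow> 'b \<Rightarrow> 'b \<Rightarrow> 'b"
  defines "I \<equiv> ([(1, Op () [Var 1, Var 2, Op () [Var 3, Var 4, Var 5]])],
      [(1, Op () [Op () [Var 1, Var 2, Var 3], Var 4, Var 5]),
       (- 1, Op () [Var 3, Op () [Var 2, Var 1, Var 4], Var 5]),
       (1, Op () [Var 3, Var 4, Op () [Var 1, Var 2, Var 5]])]) :: ('a, unit, nat) identity"
  shows "(\<forall>v\<in>identity_vars I.
      satisfies scale (ternary_ops t1 t2 t3) (kp_combination 3 v (fst I), kp_combination 3 v (snd I))) \<longleftrightarrow>
    (\<forall>a b c d e. t1 a b (t1 c d e) = t1 (t1 a b c) d e - t2 c (t2 b a d) e + t3 c d (t1 a b e)) \<and>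
    (\<forall>a b c d e. t2 a b (t1 c d e) = t1 (t2 a b c) d e - t2 c (t1 b a d) e + t3 c d (t2 a b e)) \<and>
    (\<forall>a b c d e. t3 a b (t1 c d e) = t1 (t3 a b c) d e - t1 c (t1 b a d) e + t1 c d (t1 a b e)) \<and>
    (\<forall>a b c d e. t3 a b (t2 c d e) = t2 (t3 a b c) d e - t2 c (t3 b a d) e + t2 c d (t1 a b e)) \<and>
    (\<forall>a b c d e. t3 a b (t3 c d e) = t3 (t3 a b c) d e - t3 c (t3 b a d) e + t3 c d (t3 a b e))"
proof -
  let ?sat = "\<lambda>v. satisfies scale (ternary_ops t1 t2 t3)
    (kp_combination 3 v (fst I), kp_combination 3 v (snd I))"
  note eval_defs = I_def kp_combination_def eval_combination_def ternary_ops_def arg_pos_def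
  have vars: "identity_vars I = {1, 2, 3, 4, 5}"
    by (auto simp: I_def identity_vars_def monomials_def)
  have "?sat 1 \<longleftrightarrow> (\<forall>a b c d e f :: 'b. t1 a b (t1 c d e) =
      t1 (t1 a b c) d e - t2 c (t2 b a d) e + t3 c d (t1 a b e))"
    by (rule satisfies_iff_values) (simp add: eval_defs algebra_simps)
  moreover have "?sat 2 \<longleftrightarrow> (\<forall>a b c d e f :: 'b. t2 a b (t1 c d e) =
      t1 (t2 a b c) d e - t2 c (t1 b a d) e + t3 c d (t2 a b e))"
    by (rule satisfies_iff_values) (simp add: eval_defs algebra_simps)
  moreover have "?sat 3 \<longleftrightarrow> (\<forall>a b c d e f :: 'b. t3 a b (t1 c d e) =
      t1 (t3 a b c) d e - t1 c (t1 b a d) e + t1 c d (t1 a b e))"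
    by (rule satisfies_iff_values) (simp add: eval_defs algebra_simps)
  moreover have "?sat 4 \<longleftrightarrow> (\<forall>a b c d e f :: 'b. t3 a b (t2 c d e) =
      t2 (t3 a b c) d e - t2 c (t3 b a d) e + t2 c d (t1 a b e))"
    by (rule satisfies_iff_values) (simp add: eval_defs algebra_simps)
  moreover have "?sat 5 \<longleftrightarrow> (\<forall>a b c d e f :: 'b. t3 a b (t3 c d e) =
      t3 (t3 a b c) d e - t3 c (t3 b a d) e + t3 c d (t3 a b e))"
    by (rule satisfies_iff_values) (simp add: eval_defs algebra_simps)
  ultimately show ?thesis
    unfolding vars by simp
qed

text \<open>
  The six conditions are the pairs of an outer operation and an argument position of it other than
  its own label; \<open>s\<close> and \<open>s'\<close> are the inner operations that may be interchanged there.
\<close>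

lemma satisfies_kp_part2_iff:
  fixes t1 t2 t3 :: "'b \<Rightarrow> 'b \<Rightarrow> 'b \<Rightarrow> 'b"
  shows "(\<forall>I\<in>kp_part2 3. satisfies scale (ternary_ops t1 t2 t3) I) \<longleftrightarrow>
    (\<forall>s\<in>{t1, t2, t3}. \<forall>s'\<in>{t1, t2, t3}. \<forall>a b x y z.
      t1 a (s x y z) b = t1 a (s' x y z) b \<and> t1 a b (s x y z) = t1 a b (s' x y z) \<and>
      t2 (s x y z) a b = t2 (s' x y z) a b \<and> t2 a b (s x y z) = t2 a b (s' x y z) \<and>
      t3 (s x y z) a b = t3 (s' x y z) a b \<and> t3 a (s x y z) b = t3 a (s' x y z) b)"
proof -
  define t where "t k = (if k = 1 then t1 else if k = 2 then t2 else t3)" for k :: nat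
  have t: "t 1 = t1" "t 2 = t2" "t 3 = t3"
    by (simp_all add: t_def)
  let ?I = "\<lambda>i j k l. ([(1, kp_part2_monomial 3 i j k)], [(1, kp_part2_monomial 3 i j l)])
    :: ('a, nat, nat) identity"
  let ?sat = "\<lambda>i j k l. satisfies scale (ternary_ops t1 t2 t3) (?I i j k l)"
  have labels: "{1..3} = {1, 2, 3 :: nat}"
    by auto
  have pairs: "(\<forall>i\<in>{1..3}. \<forall>j\<in>{1..3}. i \<noteq> j \<longrightarrow> P i j) \<longleftrightarrow>
      P 2 1 \<and> P 3 1 \<and> P 1 2 \<and> P 3 2 \<and> P 1 3 \<and> P 2 3" for P :: "nat \<Rightarrow> nat \<Rightarrow> bool"
    unfolding labels by auto
  have ops: "{t1, t2, t3} = t ` {1..3}"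
    by (simp only: labels image_insert image_empty t)
  have upt: "[1..<Suc 3] = [1, 2, 3]"
    by (simp add: upt_rec)
  have monomial: "kp_part2_monomial 3 i j k =
      Op j [if i = 1 then Op k [Var 4, Var 5, Var 6] else Var 1,
        if i = 2 then Op k [Var 4, Var 5, Var 6] else Var 2,
        if i = 3 then Op k [Var 4, Var 5, Var 6] else Var 3]"
    for i j k
    unfolding kp_part2_monomial_def upt by simp
  \<comment> \<open>Position \<open>i\<close> is kept symbolic, so that one computation covers all instances of Part 2.\<close>
  have sat: "?sat i j k l \<longleftrightarrow> (\<forall>a b c x y z.
      t j (if i = 1 then t k x y z else a) (if i = 2 then t k x y z else b)
        (if i = 3 then t k x y z else c) =
      t j (if i = 1 then t l x y z else a) (if i = 2 then t l x y z else b)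
        (if i = 3 then t l x y z else c))" for i j k l :: nat
    by (rule satisfies_iff_values)
      (simp add: eval_combination_def monomial ternary_ops_def t_def if_distrib[of "eval_monomial _ _"]
        cong: if_cong split del: if_split)
  have "(\<forall>I\<in>kp_part2 3. satisfies scale (ternary_ops t1 t2 t3) I) \<longleftrightarrow>
    (\<forall>k\<in>{1..3}. \<forall>l\<in>{1..3}. \<forall>i\<in>{1..3}. \<forall>j\<in>{1..3}. i \<noteq> j \<longrightarrow> ?sat i j k l)"
    unfolding kp_part2_def by blast
  also have "\<dots> \<longleftrightarrow> (\<forall>k\<in>{1..3}. \<forall>l\<in>{1..3}.
      ?sat 2 1 k l \<and> ?sat 3 1 k l \<and> ?sat 1 2 k l \<and> ?sat 3 2 k l \<and> ?sat 1 3 k l \<and> ?sat 2 3 k l)"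
    unfolding pairs by blast
  also have "\<dots> \<longleftrightarrow> (\<forall>k\<in>{1..3}. \<forall>l\<in>{1..3}. \<forall>a b x y z.
      t1 a (t k x y z) b = t1 a (t l x y z) b \<and> t1 a b (t k x y z) = t1 a b (t l x y z) \<and>
      t2 (t k x y z) a b = t2 (t l x y z) a b \<and> t2 a b (t k x y z) = t2 a b (t l x y z) \<and>
      t3 (t k x y z) a b = t3 (t l x y z) a b \<and> t3 a (t k x y z) b = t3 a (t l x y z) b)"
    unfolding sat by (intro ball_cong refl) (simp add: t all_conj_distrib del: One_nat_def)
  finally show ?thesis
    by (simp only: ops ball_simps)
qed

end

section \<open>Elimination of the third operation\<close>

text \<open>
  Reversal turns positions \<open>1\<close> and \<open>2\<close> of \<open>{-, -, -}\<^sub>3\<close> into positions \<open>3\<close> and \<open>2\<close> of \<open>{-, -, -}\<^sub>1\<close>, and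
  exchanges positions \<open>1\<close> and \<open>3\<close> of \<open>{-, -, -}\<^sub>2\<close>, so three positions remain. In each of them, the
  equality of all three inner operations is one chain of two equations.
\<close>

lemma interchange_iff_if_reversal:
  fixes t1 t2 t3 :: "'b \<Rightarrow> 'b \<Rightarrow> 'b \<Rightarrow> 'b"
  assumes t3: "\<And>a b c. t3 a b c = t1 c b a" and t2: "\<And>a b c. t2 a b c = t2 c b a"
  shows "(\<forall>s\<in>{t1, t2, t3}. \<forall>s'\<in>{t1, t2, t3}. \<forall>a b x y z.
      t1 a (s x y z) b = t1 a (s' x y z) b \<and> t1 a b (s x y z) = t1 a b (s' x y z) \<and>
      t2 (s x y z) a b = t2 (s' x y z) a b \<and> t2 a b (s x y z) = t2 a b (s' x y z) \<and>
      t3 (s x y z) a b = t3 (s' x y z) a b \<and> t3 a (s x y z) b = t3 a (s' x y z) b) \<longleftrightarrow>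
    (\<forall>a b c d e. t1 a (t1 b c d) e = t1 a (t2 b c d) e \<and>
      t1 a (t2 b c d) e = t1 a (t1 d c b) e) \<and>
    (\<forall>a b c d e. t1 a b (t1 c d e) = t1 a b (t2 c d e) \<and>
      t1 a b (t2 c d e) = t1 a b (t1 e d c)) \<and>
    (\<forall>a b c d e. t2 (t1 a b c) d e = t2 (t2 a b c) d e \<and>
      t2 (t2 a b c) d e = t2 (t1 c b a) d e)"
    (is "?part2 \<longleftrightarrow> ?chains")
proof -
  from t3 have t3: "t3 = (\<lambda>a b c. t1 c b a)"
    by blast
  have "?part2 \<longleftrightarrow> (\<forall>s\<in>{t1, t2, t3}. \<forall>s'\<in>{t1, t2, t3}. \<forall>a b x y z.
      t1 a (s x y z) b = t1 a (s' x y z) b \<and> t1 a b (s x y z) = t1 a b (s' x y z) \<and>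
      t2 (s x y z) a b = t2 (s' x y z) a b)"
  proof (intro ball_cong refl)
    fix s s'
    show "(\<forall>a b x y z.
        t1 a (s x y z) b = t1 a (s' x y z) b \<and> t1 a b (s x y z) = t1 a b (s' x y z) \<and>
        t2 (s x y z) a b = t2 (s' x y z) a b \<and> t2 a b (s x y z) = t2 a b (s' x y z) \<and>
        t3 (s x y z) a b = t3 (s' x y z) a b \<and> t3 a (s x y z) b = t3 a (s' x y z) b) \<longleftrightarrow>
      (\<forall>a b x y z.
        t1 a (s x y z) b = t1 a (s' x y z) b \<and> t1 a b (s x y z) = t1 a b (s' x y z) \<and>
        t2 (s x y z) a b = t2 (s' x y z) a b)" (is "?all \<longleftrightarrow> ?some")
    proof
      assume ?some
      then have eqs: "t1 a (s x y z) b = t1 a (s' x y z) b" "t1 a b (s x y z) = t1 a b (s' x y z)"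
        "t2 (s x y z) a b = t2 (s' x y z) a b" for a b x y z
        by blast+
      have "t2 a b (s x y z) = t2 a b (s' x y z)" for a b x y z
        using eqs(3)[of x y z b a] by (simp only: t2[of a])
      with eqs show ?all
        by (simp add: t3)
    qed blast
  qed
  also have "\<dots> \<longleftrightarrow> ?chains" (is "?equal \<longleftrightarrow> _")
  proof
    assume equal: ?equal
    have eqs: "t1 a (s x y z) b = t1 a (s' x y z) b" "t1 a b (s x y z) = t1 a b (s' x y z)"
      "t2 (s x y z) a b = t2 (s' x y z) a b"
      if "s \<in> {t1, t2, t3}" "s' \<in> {t1, t2, t3}" for s s' a b x y z
      using equal[THEN bspec, OF that(1), THEN bspec, OF that(2)] by blast+
    \<comment> \<open>The two links of each chain are the pairs of labels \<open>(1, 2)\<close> and \<open>(2, 3)\<close>.\<close>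
    have "t1 a (t1 x y z) b = t1 a (t2 x y z) b" "t1 a b (t1 x y z) = t1 a b (t2 x y z)"
      "t2 (t1 x y z) a b = t2 (t2 x y z) a b" for a b x y z
      by (rule eqs; simp)+
    moreover have "t1 a (t2 x y z) b = t1 a (t1 z y x) b" "t1 a b (t2 x y z) = t1 a b (t1 z y x)"
      "t2 (t2 x y z) a b = t2 (t1 z y x) a b" for a b x y z
      using eqs[of t2 t3] by (simp_all add: t3)
    ultimately show ?chains
      by (intro conjI allI)
  next
    assume ?chains
    \<comment> \<open>Every inner operation is brought to the form \<open>t1 x y z\<close>; for \<open>t3\<close> this is a reversal.\<close>
    then have "t1 a (t2 b c d) e = t1 a (t1 b c d) e" "t1 a (t1 d c b) e = t1 a (t1 b c d) e"
      "t1 a b (t2 c d e) = t1 a b (t1 c d e)" "t1 a b (t1 e d c) = t1 a b (t1 c d e)"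
      "t2 (t2 a b c) d e = t2 (t1 a b c) d e" "t2 (t1 c b a) d e = t2 (t1 a b c) d e" for a b c d e
      by metis+
    then have to_t1: "t1 a (s b c d) e = t1 a (t1 b c d) e" "t1 a b (s c d e) = t1 a b (t1 c d e)"
      "t2 (s a b c) d e = t2 (t1 a b c) d e" if "s \<in> {t1, t2, t3}" for s a b c d e
      using that by (auto simp: t3)
    show ?equal
    proof (intro ballI allI, goal_cases)
      case (1 s s')
      then show ?case
        by (simp only: to_t1[OF 1(1)] to_t1[OF 1(2)])
    qed
  qed
  finally show ?thesis .
qed

text \<open>
  The three swaps are consequences of Part 2 and undo the reversals of inner operations that
  remain when \<open>t3\<close> is expressed by \<open>t1\<close>. The two conditions on \<open>t1 (t1 e d c) b a\<close> arising
  from the central arguments \<open>c\<close> and \<open>e\<close> coincide.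
\<close>

lemma derivation_iff_if_reversal:
  fixes t1 t2 t3 :: "'b::ab_group_add \<Rightarrow> 'b \<Rightarrow> 'b \<Rightarrow> 'b"
  assumes t3: "\<And>a b c. t3 a b c = t1 c b a" and t2: "\<And>a b c. t2 a b c = t2 c b a"
    and swap_middle: "\<And>a b c d e. t1 a (t1 b c d) e = t1 a (t1 d c b) e"
    and swap_right: "\<And>a b c d e. t1 a b (t1 c d e) = t1 a b (t1 e d c)"
    and swap_left: "\<And>a b c d e. t2 (t1 a b c) d e = t2 (t1 c b a) d e"
  shows "((\<forall>a b c d e. t1 a b (t1 c d e) = t1 (t1 a b c) d e - t2 c (t2 b a d) e + t3 c d (t1 a b e)) \<and>
     (\<forall>a b c d e. t2 a b (t1 c d e) = t1 (t2 a b c) d e - t2 c (t1 b a d) e + t3 c d (t2 a b e)) \<and>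
     (\<forall>a b c d e. t3 a b (t1 c d e) = t1 (t3 a b c) d e - t1 c (t1 b a d) e + t1 c d (t1 a b e)) \<and>
     (\<forall>a b c d e. t3 a b (t2 c d e) = t2 (t3 a b c) d e - t2 c (t3 b a d) e + t2 c d (t1 a b e)) \<and>
     (\<forall>a b c d e. t3 a b (t3 c d e) = t3 (t3 a b c) d e - t3 c (t3 b a d) e + t3 c d (t3 a b e))) \<longleftrightarrow>
    (\<forall>a b c d e. t1 (t1 e d c) b a =
      t1 (t1 e b a) d c - t1 e (t1 d a b) c + t1 e d (t1 c b a)) \<and>
    (\<forall>a b c d e. t1 (t2 e d c) b a =
      t2 (t1 e b a) d c - t2 e (t1 d a b) c + t2 e d (t1 c b a)) \<and>
    (\<forall>a b c d e. t1 a b (t1 c d e) =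
      t1 (t1 a b c) d e - t2 c (t2 b a d) e + t1 (t1 a b e) d c) \<and>
    (\<forall>a b c d e. t2 a b (t1 c d e) =
      t1 (t2 a b c) d e - t2 c (t1 b a d) e + t1 (t2 a b e) d c)"
proof -
  from t3 have t3: "t3 = (\<lambda>a b c. t1 c b a)"
    by blast
  have swap_right2: "t2 a b (t1 c d e) = t2 a b (t1 e d c)" for a b c d e
    using swap_left[of c d e b a] by (simp only: t2[of a])
  \<comment> \<open>The first two conditions to be reached exchange the names of \<open>c\<close> and \<open>e\<close> relative to the Jordan identity.\<close>
  have swap_outer: "(\<forall>a b c d e. P a b c d e) \<longleftrightarrow> (\<forall>a b c d e. P a b e d c)"
    for P :: "'b \<Rightarrow> 'b \<Rightarrow> 'b \<Rightarrow> 'b \<Rightarrow> 'b \<Rightarrow> bool"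
    by blast
  have central_c: "(\<forall>a b c d e. t3 a b (t1 c d e) =
      t1 (t3 a b c) d e - t1 c (t1 b a d) e + t1 c d (t1 a b e)) \<longleftrightarrow>
    (\<forall>a b c d e. t1 (t1 e d c) b a =
      t1 (t1 e b a) d c - t1 e (t1 d a b) c + t1 e d (t1 c b a))"
    unfolding t3 by (subst swap_outer) (simp only: swap_middle swap_right)
  have central_d: "(\<forall>a b c d e. t3 a b (t2 c d e) =
      t2 (t3 a b c) d e - t2 c (t3 b a d) e + t2 c d (t1 a b e)) \<longleftrightarrow>
    (\<forall>a b c d e. t1 (t2 e d c) b a =
      t2 (t1 e b a) d c - t2 e (t1 d a b) c + t2 e d (t1 c b a))"
    unfolding t3 by (subst swap_outer) (simp only: swap_right2)
  have central_e: "(\<forall>a b c d e. t3 a b (t3 c d e) =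
      t3 (t3 a b c) d e - t3 c (t3 b a d) e + t3 c d (t3 a b e)) \<longleftrightarrow>
    (\<forall>a b c d e. t1 (t1 e d c) b a =
      t1 (t1 e b a) d c - t1 e (t1 d a b) c + t1 e d (t1 c b a))"
    unfolding t3 by (simp add: algebra_simps)
  show ?thesis
    unfolding central_c central_d central_e unfolding t3 by argo
qed

section \<open>The reduced system of identities\<close>

theorem theorem4p2:
  fixes scale :: "'k::field \<Rightarrow> 'b::ab_group_add \<Rightarrow> 'b"
    and t1 t2 t3 :: "'b \<Rightarrow> 'b \<Rightarrow> 'b \<Rightarrow> 'b"
  assumes "vector_space scale"
    and "CHAR('k) \<noteq> 2"
    and "trilinear scale t1" and "trilinear scale t2" and "trilinear scale t3"
  shows "(\<forall>I\<in>kp_identities 3 (jts_identities :: ('k, unit, nat) identity set).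
            satisfies scale (ternary_ops t1 t2 t3) I) \<longleftrightarrow>
         (\<forall>a b c. t3 a b c = t1 c b a) \<and>
         (\<forall>a b c. t2 a b c = t2 c b a) \<and>
         (\<forall>a b c d e. t1 a (t1 b c d) e = t1 a (t2 b c d) e \<and>
                      t1 a (t2 b c d) e = t1 a (t1 d c b) e) \<and>
         (\<forall>a b c d e. t1 a b (t1 c d e) = t1 a b (t2 c d e) \<and>
                      t1 a b (t2 c d e) = t1 a b (t1 e d c)) \<and>
         (\<forall>a b c d e. t2 (t1 a b c) d e = t2 (t2 a b c) d e \<and>
                      t2 (t2 a b c) d e = t2 (t1 c b a) d e) \<and>
         (\<forall>a b c d e. t1 (t1 e d c) b a =
            t1 (t1 e b a) d c - t1 e (t1 d a b) c + t1 e d (t1 c b a)) \<and>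
         (\<forall>a b c d e. t1 (t2 e d c) b a =
            t2 (t1 e b a) d c - t2 e (t1 d a b) c + t2 e d (t1 c b a)) \<and>
         (\<forall>a b c d e. t1 a b (t1 c d e) =
            t1 (t1 a b c) d e - t2 c (t2 b a d) e + t1 (t1 a b e) d c) \<and>
         (\<forall>a b c d e. t2 a b (t1 c d e) =
            t1 (t2 a b c) d e - t2 c (t1 b a d) e + t1 (t2 a b e) d c)"
proof -
  interpret vector_space scale by fact
  have kp_iff: "(\<forall>I\<in>kp_identities 3 (jts_identities :: ('k, unit, nat) identity set).
            satisfies scale (ternary_ops t1 t2 t3) I) \<longleftrightarrow>
    ((\<forall>a b c. t3 a b c = t1 c b a) \<and> (\<forall>a b c. t2 a b c = t2 c b a)) \<and>
    ((\<forall>a b c d e. t1 a b (t1 c d e) = t1 (t1 a b c) d e - t2 c (t2 b a d) e + t3 c d (t1 a b e)) \<and>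
     (\<forall>a b c d e. t2 a b (t1 c d e) = t1 (t2 a b c) d e - t2 c (t1 b a d) e + t3 c d (t2 a b e)) \<and>
     (\<forall>a b c d e. t3 a b (t1 c d e) = t1 (t3 a b c) d e - t1 c (t1 b a d) e + t1 c d (t1 a b e)) \<and>
     (\<forall>a b c d e. t3 a b (t2 c d e) = t2 (t3 a b c) d e - t2 c (t3 b a d) e + t2 c d (t1 a b e)) \<and>
     (\<forall>a b c d e. t3 a b (t3 c d e) = t3 (t3 a b c) d e - t3 c (t3 b a d) e + t3 c d (t3 a b e))) \<and>
    (\<forall>s\<in>{t1, t2, t3}. \<forall>s'\<in>{t1, t2, t3}. \<forall>a b x y z.
      t1 a (s x y z) b = t1 a (s' x y z) b \<and> t1 a b (s x y z) = t1 a b (s' x y z) \<and>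
      t2 (s x y z) a b = t2 (s' x y z) a b \<and> t2 a b (s x y z) = t2 a b (s' x y z) \<and>
      t3 (s x y z) a b = t3 (s' x y z) a b \<and> t3 a (s x y z) b = t3 a (s' x y z) b)"
    (is "?KP \<longleftrightarrow> ?reversal \<and> ?derivation \<and> ?part2")
    unfolding kp_identities_def ball_Un ball_kp_part1_iff jts_identities_def Let_def
      ball_simps(7) satisfies_kp_reversal_iff satisfies_kp_derivation_iff satisfies_kp_part2_iff
    by simp
  let ?chains = "(\<forall>a b c d e. t1 a (t1 b c d) e = t1 a (t2 b c d) e \<and>
      t1 a (t2 b c d) e = t1 a (t1 d c b) e) \<and>
    (\<forall>a b c d e. t1 a b (t1 c d e) = t1 a b (t2 c d e) \<and>
      t1 a b (t2 c d e) = t1 a b (t1 e d c)) \<and>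
    (\<forall>a b c d e. t2 (t1 a b c) d e = t2 (t2 a b c) d e \<and>
      t2 (t2 a b c) d e = t2 (t1 c b a) d e)"
  let ?derivation' = "(\<forall>a b c d e. t1 (t1 e d c) b a =
      t1 (t1 e b a) d c - t1 e (t1 d a b) c + t1 e d (t1 c b a)) \<and>
    (\<forall>a b c d e. t1 (t2 e d c) b a =
      t2 (t1 e b a) d c - t2 e (t1 d a b) c + t2 e d (t1 c b a)) \<and>
    (\<forall>a b c d e. t1 a b (t1 c d e) =
      t1 (t1 a b c) d e - t2 c (t2 b a d) e + t1 (t1 a b e) d c) \<and>
    (\<forall>a b c d e. t2 a b (t1 c d e) =
      t1 (t2 a b c) d e - t2 c (t1 b a d) e + t1 (t2 a b e) d c)"
  have "?part2 \<longleftrightarrow> ?chains" if ?reversal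
    by (rule interchange_iff_if_reversal) (use that in blast)+
  moreover have "?derivation \<longleftrightarrow> ?derivation'" if ?reversal ?chains
    by (rule derivation_iff_if_reversal) (use that in metis)+
  ultimately show ?thesis
    unfolding kp_iff by argo
qed

end
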